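(* Let $\mathbb{F}$ be a field, $V=\mathbb{F}^n$, and $A\in M_n(\mathbb{F})$. Assume that the minimal polynomial of $A$ is $m_A=p^r$ with $r\ge 1$ and $p\in\mathbb{F}[x]$ irreducible and separable of degree $s$. Let $A=S+N$ be the Jordan-Chevalley decomposition of $A$, and let $\mathbb{K}=\{a_0I_n+a_1S+\cdots+a_{s-1}S^{s-1} : a_i\in\mathbb{F}\}$. Then $$\operatorname{Chinv}_{\mathbb{F}}(A)=\operatorname{Chinv}_{\mathbb{K}}(A)=\operatorname{Chinv}_{\mathbb{K}}(N).$$
   Context: A polynomial is separable if it is coprime with its derivative. The Jordan-Chevalley decomposition of $A$ is the unique decomposition $A=S+N$ with $S,N\in M_n(\mathbb{F})$, $S$ semisimple (every $S$-invariant subspace has an $S$-invariant complement), $N$ nilpotent and $SN=NS$; it exists under the stated hypotheses, and $S$ and $N$ are polynomials in $A$. The set $\mathbb{K}$ is a field (isomorphic to $\mathbb{F}[x]/(p)$), and $V$ is a $\mathbb{K}$-vector space via the action of matrices on vectors; $A$, $S$, $N$ are $\mathbb{K}$-linear maps of $V$. For $\mathbb{L}\in\{\mathbb{F},\mathbb{K}\}$ and an $\mathbb{L}$-linear endomorphism $T$ of $V$, $\operatorname{Chinv}_{\mathbb{L}}(T)$ denotes the lattice of characteristic subspaces of $T$ over $\mathbb{L}$: those $\mathbb{L}$-subspaces $Y\subseteq V$ such that $TY\subseteq Y$ and $XY\subseteq Y$ for every $\mathbb{L}$-linear automorphism $X$ of $V$ with $TX=XT$. *)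

theory Defs
  imports "HOL-Analysis.Analysis" "HOL-Computational_Algebra.Polynomial"
begin

(* The class operations * and ^ on 'a^'n^'n act componentwise, so powers with respect to
   the matrix product ** are defined separately. *)
primrec mat_power :: "'a::semiring_1^'n^'n \<Rightarrow> nat \<Rightarrow> 'a^'n^'n" where
  "mat_power A 0 = mat 1"
| "mat_power A (Suc k) = A ** mat_power A k"

definition mat_poly :: "'a::field poly \<Rightarrow> 'a^'n^'n \<Rightarrow> 'a^'n^'n" where
  "mat_poly q A = (\<Sum>i\<le>degree q. mat (coeff q i) ** mat_power A i)"

definition is_minimal_poly :: "'a::field^'n^'n \<Rightarrow> 'a poly \<Rightarrow> bool" where
  "is_minimal_poly A m \<longleftrightarrow>
     lead_coeff m = 1 \<and> mat_poly m A = 0 \<and>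
     (\<forall>q. q \<noteq> 0 \<and> mat_poly q A = 0 \<longrightarrow> degree m \<le> degree q)"

definition separable_poly :: "'a::field poly \<Rightarrow> bool" where
  "separable_poly p \<longleftrightarrow> coprime p (pderiv p)"

definition semisimple_mat :: "'a::field^'n^'n \<Rightarrow> bool" where
  "semisimple_mat S \<longleftrightarrow>
     (\<forall>U. vec.subspace U \<and> (*v) S ` U \<subseteq> U \<longrightarrow>
        (\<exists>W. vec.subspace W \<and> (*v) S ` W \<subseteq> W \<and>
             U \<inter> W = {0} \<and> (\<forall>v. \<exists>u\<in>U. \<exists>w\<in>W. v = u + w)))"

definition nilpotent_mat :: "'a::field^'n^'n \<Rightarrow> bool" where
  "nilpotent_mat N \<longleftrightarrow> (\<exists>k. mat_power N k = 0)"

definition jordan_chevalley :: "'a::field^'n^'n \<Rightarrow> 'a^'n^'n \<Rightarrow> 'a^'n^'n \<Rightarrow> bool" where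
  "jordan_chevalley A S N \<longleftrightarrow>
     A = S + N \<and> semisimple_mat S \<and> nilpotent_mat N \<and> S ** N = N ** S"

(* K as a set of matrices; it acts on vectors by *v. *)
definition coeff_field :: "'a::field^'n^'n \<Rightarrow> nat \<Rightarrow> ('a^'n^'n) set" where
  "coeff_field S s = range (\<lambda>a :: nat \<Rightarrow> 'a. \<Sum>i<s. mat (a i) ** mat_power S i)"

(* Linear algebra over a field of scalars given as a set L with an action sc. This is needed
   because the field K depends on the matrix A and so is not a type. The base field F is
   the case L = UNIV, sc = ( *s); the lemmas below identify that case with the library notions. *)
definition subspace_over :: "'s set \<Rightarrow> ('s \<Rightarrow> 'v \<Rightarrow> 'v) \<Rightarrow> 'v::ab_group_add set \<Rightarrow> bool" where
  "subspace_over L sc Y \<longleftrightarrow>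
     0 \<in> Y \<and> (\<forall>x\<in>Y. \<forall>y\<in>Y. x + y \<in> Y) \<and> (\<forall>c\<in>L. \<forall>x\<in>Y. sc c x \<in> Y)"

definition linear_over :: "'s set \<Rightarrow> ('s \<Rightarrow> 'v \<Rightarrow> 'v) \<Rightarrow> ('v::ab_group_add \<Rightarrow> 'v) \<Rightarrow> bool" where
  "linear_over L sc f \<longleftrightarrow>
     (\<forall>x y. f (x + y) = f x + f y) \<and> (\<forall>c\<in>L. \<forall>x. f (sc c x) = sc c (f x))"

definition Chinv :: "'s set \<Rightarrow> ('s \<Rightarrow> 'v \<Rightarrow> 'v) \<Rightarrow> ('v::ab_group_add \<Rightarrow> 'v) \<Rightarrow> 'v set set" where
  "Chinv L sc T =
     {Y. subspace_over L sc Y \<and> T ` Y \<subseteq> Y \<and>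
         (\<forall>X. linear_over L sc X \<and> bij X \<and> T \<circ> X = X \<circ> T \<longrightarrow> X ` Y \<subseteq> Y)}"

lemma subspace_over_base_field:
  "subspace_over UNIV ((*s) :: 'a::field \<Rightarrow> 'a^'n \<Rightarrow> 'a^'n) Y \<longleftrightarrow> vec.subspace Y"
  by (auto simp: subspace_over_def vec.subspace_def)

lemma linear_over_base_field:
  "linear_over UNIV ((*s) :: 'a::field \<Rightarrow> 'a^'n \<Rightarrow> 'a^'n) f \<longleftrightarrow> Vector_Spaces.linear (*s) (*s) f"
  by (auto simp: linear_over_def Vector_Spaces.linear_def module_hom_iff vec.vector_space_axioms vec.module_axioms)

abbreviation ChinvF :: "'a::field^'n^'n \<Rightarrow> ('a^'n) set set" where
  "ChinvF T \<equiv> Chinv (UNIV :: 'a set) (*s) ((*v) T)"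

abbreviation ChinvK :: "('a::field^'n^'n) set \<Rightarrow> 'a^'n^'n \<Rightarrow> ('a^'n) set set" where
  "ChinvK K T \<equiv> Chinv K (*v) ((*v) T)"

end

theory Submission
  imports Defs
begin

text \<open>
  The point of the theorem is that \<open>S\<close> is a polynomial in \<open>A\<close>.  Once this is known, a linear map
  that commutes with \<open>A\<close> commutes with \<open>S\<close>, hence with \<open>N = A - S\<close> and with every
  element of \<open>K\<close>, and a subspace that is invariant under \<open>A\<close> is invariant under all of these as
  well.  Conversely \<open>K\<close> contains the scalar matrices and \<open>S\<close> itself, so \<open>K\<close>-linearity implies
  \<open>F\<close>-linearity, and for \<open>K\<close>-linear objects compatibility with \<open>A\<close> and with \<open>N\<close> are the same.
  So the three sets of characteristic subspaces are defined by the same automorphisms and by the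
  same invariant subspaces.

  That \<open>S\<close> is a polynomial in \<open>A\<close> is proved in two steps.  As \<open>p(A)\<close> and \<open>N = A - S\<close> are
  nilpotent and commute, \<open>p(S)\<close> is nilpotent, and since \<open>S\<close> is semisimple this forces
  \<open>p(S) = 0\<close> (\<open>semisimple_nilpotent_eval_zero\<close>).  Separability gives \<open>a p + b p' = 1\<close>, and with
  this Newton's iteration \<open>B \<mapsto> B - b(B) p(B)\<close>, started at \<open>B = A\<close>, approximates the root
  \<open>S\<close> of \<open>p\<close>: all iterates are polynomials in \<open>A\<close>, and their distance from \<open>S\<close> is
  divisible by higher and higher powers of the nilpotent matrix \<open>N\<close> (\<open>newton_approximation\<close>).

  Both steps are identities between commuting matrices.  They are proved as identities in the
  commutative ring \<open>F[x][y]\<close> and transported to matrices by the ring homomorphism with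
  \<open>x \<mapsto> S\<close> and \<open>y \<mapsto> N\<close>.
\<close>

section \<open>Evaluating polynomials at matrices\<close>

lemma mat_add: "mat (c + d) = mat c + (mat d :: 'a::semiring_1^'n^'n)"
  by (simp add: mat_def vec_eq_iff)

lemma mat_mult_vector: "mat c *v x = c *s (x :: 'a::semiring_1^'n)"
proof -
  have "(if P then c else 0) * b = (if P then c * b else 0)" for P b by simp
  then show ?thesis by (simp add: mat_def matrix_vector_mult_def vec_eq_iff)
qed

lemma mat_mult_left: "mat c ** M = (\<chi> i. c *s M $ i)" for M :: "'a::semiring_1^'m^'n"
proof -
  have "(if P then c else 0) * b = (if P then c * b else 0)" for P b by simp
  then show ?thesis by (simp add: mat_def matrix_matrix_mult_def vec_eq_iff)
qed

lemma mat_mult_right: "M ** mat c = (\<chi> i j. M $ i $ j * c)" for M :: "'a::semiring_1^'m^'n"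
proof -
  have "b * (if P then c else 0) = (if P then b * c else 0)" for P b by simp
  then show ?thesis by (simp add: mat_def matrix_matrix_mult_def vec_eq_iff)
qed

lemma mat_mult: "mat (c * d) = mat c ** (mat d :: 'a::semiring_1^'n^'n)"
  unfolding mat_mult_left by (simp add: mat_def vec_eq_iff)

lemma mat_commute: "mat c ** M = M ** (mat c :: 'a::comm_semiring_1^'n^'n)"
  by (simp add: mat_mult_left mat_mult_right vec_eq_iff mult.commute)

lemma mat_power_commute: "M ** mat_power M k = mat_power M k ** M"
  by (induction k) (simp_all add: matrix_mul_assoc)

lemma matrix_add_rdistrib: "(A + B) ** C = A ** C + B ** (C :: 'a::semiring_1^'n^'m)"
  by (simp add: matrix_matrix_mult_def vec_eq_iff sum.distrib distrib_right)

text \<open>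
  The map \<open>h\<close> from coefficients to matrices is left open because two instances are needed.  For
  \<open>h = mat\<close> this is \<^const>\<open>mat_poly\<close>; for \<open>h = (\<lambda>q. mat_poly q S)\<close> it evaluates polynomials in
  two variables, represented as polynomials with polynomial coefficients.
\<close>
definition matrix_eval ::
    "('r::zero \<Rightarrow> 'a::semiring_1^'n^'n) \<Rightarrow> 'a^'n^'n \<Rightarrow> 'r poly \<Rightarrow> 'a^'n^'n" where
  "matrix_eval h M P = (\<Sum>i\<le>degree P. h (coeff P i) ** mat_power M i)"

lemma matrix_eval_atMost:
  assumes "degree P \<le> n" and "h 0 = 0"
  shows "matrix_eval h M P = (\<Sum>i\<le>n. h (coeff P i) ** mat_power M i)"
  unfolding matrix_eval_def
  using assms by (intro sum.mono_neutral_left) (auto simp: coeff_eq_0)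

locale matrix_evaluation =
  fixes h :: "'r::comm_ring_1 \<Rightarrow> 'a::field^'n^'n" and M :: "'a^'n^'n"
  assumes h_add: "h (c + d) = h c + h d"
    and h_mult: "h (c * d) = h c ** h d"
    and h_one: "h 1 = mat 1"
    and h_commute: "h c ** M = M ** h c"
begin

abbreviation ev :: "'r poly \<Rightarrow> 'a^'n^'n" where
  "ev \<equiv> matrix_eval h M"

lemma h_zero: "h 0 = 0"
  using h_add[of 0 0] by simp

lemma ev_zero: "ev 0 = 0"
  by (simp add: matrix_eval_def h_zero)

lemma ev_pCons: "ev (pCons c P) = h c + M ** ev P"
proof -
  have "ev (pCons c P)
      = (\<Sum>i\<le>Suc (degree P). h (coeff (pCons c P) i) ** mat_power M i)"
    by (rule matrix_eval_atMost) (simp_all add: h_zero degree_pCons_le)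
  also have "\<dots> = h c + (\<Sum>i\<le>degree P. h (coeff P i) ** (M ** mat_power M i))"
    by (simp add: sum.atMost_Suc_shift del: sum.atMost_Suc)
  also have "(\<Sum>i\<le>degree P. h (coeff P i) ** (M ** mat_power M i)) = M ** ev P"
  proof -
    have sum: "M ** (\<Sum>i\<in>I. f i) = (\<Sum>i\<in>I. M ** f i)" for I :: "nat set" and f
      by (induction I rule: infinite_finite_induct) (simp_all add: matrix_add_ldistrib)
    show ?thesis
      unfolding matrix_eval_def sum by (simp add: matrix_mul_assoc h_commute)
  qed
  finally show ?thesis .
qed

lemma ev_const: "ev [:c:] = h c"
  by (simp add: ev_pCons ev_zero)

lemma ev_one: "ev 1 = mat 1"
  by (simp add: one_pCons ev_const h_one)

lemma ev_var: "ev [:0, 1:] = M"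
  by (simp add: ev_pCons ev_zero h_zero h_one)

lemma ev_add: "ev (P + Q) = ev P + ev Q"
  by (induction P Q rule: poly_induct2)
    (simp_all add: ev_zero ev_pCons h_add matrix_add_ldistrib algebra_simps)

lemma ev_diff: "ev (P - Q) = ev P - ev Q"
  using ev_add[of "P - Q" Q] by simp

lemma ev_smult: "ev (smult c P) = h c ** ev P"
  by (induction P)
    (simp_all add: ev_zero ev_pCons h_mult matrix_add_ldistrib matrix_mul_assoc h_commute)

lemma ev_mult: "ev (P * Q) = ev P ** ev Q"
  by (induction P)
    (simp_all add: ev_zero ev_pCons ev_add ev_smult h_zero matrix_add_rdistrib matrix_mul_assoc)

lemma ev_power: "ev (P ^ k) = mat_power (ev P) k"
  by (induction k) (simp_all add: ev_one ev_mult)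

lemma ev_commute_var: "ev P ** M = M ** ev P"
  using ev_mult[of P "[:0, 1:]"] ev_mult[of "[:0, 1:]" P] by (simp add: ev_var mult.commute)

end

lemma mat_poly_eq_matrix_eval: "mat_poly = (\<lambda>q A. matrix_eval mat A q)"
  by (simp add: fun_eq_iff mat_poly_def matrix_eval_def)

text \<open>
  From here on the rules for matrix evaluation are available for \<^const>\<open>mat_poly\<close>, under the
  prefix \<open>uni\<close>.
\<close>
interpretation uni: matrix_evaluation mat A
  rewrites "matrix_eval mat A q = mat_poly q A"
  for A :: "'a::field^'n^'n" and q
  by (unfold_locales, rule mat_add, rule mat_mult, rule refl, rule mat_commute)
    (simp add: mat_poly_eq_matrix_eval)

lemma mat_poly_mult_vector_pCons: "mat_poly (pCons c q) A *v v = c *s v + A *v (mat_poly q A *v v)"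
  by (simp add: uni.ev_pCons matrix_vector_mult_add_rdistrib mat_mult_vector
      matrix_vector_mul_assoc)

section \<open>Bezout and Newton\<close>

text \<open>
  The Euclidean algorithm preserves coprimality and ends at a unit and \<open>0\<close>.  Stated without reference
  to a chosen greatest common divisor, this covers polynomials over an arbitrary field.
\<close>
lemma coprime_bezout:
  fixes a b :: "'a::euclidean_ring"
  assumes "coprime a b"
  shows "\<exists>u v. u * a + v * b = 1"
  using assms
proof (induction "euclidean_size b" arbitrary: a b rule: less_induct)
  case less
  show ?case
  proof (cases "b = 0")
    case True
    with less.prems have "a dvd 1" by simp
    then obtain u where "1 = a * u" by (rule dvdE)
    with True show ?thesis by (intro exI[of _ u]) (simp add: mult.commute)
  next
    case False
    from less.prems have "coprime b (a mod b)"
      using False by (simp add: coprime_commute)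
    with False obtain u v where *: "u * b + v * (a mod b) = 1"
      using less.hyps[of "a mod b" b] mod_size_less by blast
    have "v * a + (u - v * (a div b)) * b = u * b + v * (a - a div b * b)"
      by (simp add: algebra_simps)
    also have "\<dots> = 1"
      using * by (simp add: minus_div_mult_eq_mod)
    finally show ?thesis by blast
  qed
qed

text \<open>
  This is \<open>g(B)\<close> in \<open>F[x][y]\<close>, with the coefficients of \<open>g\<close> embedded as constants in both
  variables.  In contrast to \<open>[:g:]\<close>, which is \<open>g(x)\<close>, it allows any \<open>B\<close>, in particular \<open>x + y\<close>.
\<close>
definition scalar_subst :: "'a::comm_ring_1 poly \<Rightarrow> 'a poly poly \<Rightarrow> 'a poly poly" where
  "scalar_subst g B = poly (map_poly (\<lambda>c. [:[:c:]:]) g) B"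

lemma scalar_subst_zero: "scalar_subst 0 B = 0"
  by (simp add: scalar_subst_def)

lemma scalar_subst_pCons: "scalar_subst (pCons c g) B = [:[:c:]:] + B * scalar_subst g B"
  by (simp add: scalar_subst_def map_poly_pCons)

lemma scalar_subst_const: "scalar_subst [:c:] B = [:[:c:]:]"
  by (simp add: scalar_subst_zero scalar_subst_pCons)

lemma scalar_subst_one: "scalar_subst 1 B = 1"
  by (simp add: one_pCons scalar_subst_const)

lemma scalar_subst_add: "scalar_subst (f + g) B = scalar_subst f B + scalar_subst g B"
proof (induction f g rule: poly_induct2)
  case (pCons c f d g)
  have "[:[:c + d:]:] = [:[:c:]:] + [:[:d:]:]" by simp
  with pCons show ?case
    by (simp only: add_pCons scalar_subst_pCons) (simp add: algebra_simps)
qed (simp add: scalar_subst_zero)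

lemma scalar_subst_diff: "scalar_subst (f - g) B = scalar_subst f B - scalar_subst g B"
  using scalar_subst_add[of "f - g" g B] by simp

lemma scalar_subst_smult: "scalar_subst (smult c g) B = [:[:c:]:] * scalar_subst g B"
proof (induction g)
  case (pCons d g)
  have "[:[:c * d:]:] = [:[:c:]:] * [:[:d:]:]" by simp
  with pCons show ?case
    by (simp only: smult_pCons scalar_subst_pCons distrib_left mult.left_commute)
qed (simp add: scalar_subst_zero)

lemma scalar_subst_mult: "scalar_subst (f * g) B = scalar_subst f B * scalar_subst g B"
proof (induction f)
  case (pCons c f)
  have "[:[:0::'a:]:] = 0" by simp
  with pCons show ?case
    by (simp only: mult_pCons_left scalar_subst_add scalar_subst_smult scalar_subst_pCons
        distrib_right mult.assoc add_0)
qed (simp add: scalar_subst_zero)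

lemma scalar_subst_pcompose:
  "scalar_subst (pcompose f g) B = scalar_subst f (scalar_subst g B)"
  by (induction f)
    (simp_all only: pcompose_0 pcompose_pCons scalar_subst_zero scalar_subst_add
      scalar_subst_mult scalar_subst_const scalar_subst_pCons mult_zero_right add_0_right)

lemma scalar_subst_taylor:
  "\<exists>E. scalar_subst g (B + D) = scalar_subst g B + scalar_subst (pderiv g) B * D + D\<^sup>2 * E"
proof (induction g)
  case 0
  show ?case by (intro exI[of _ 0]) (simp add: scalar_subst_zero)
next
  case (pCons c g)
  then obtain E where
    E: "scalar_subst g (B + D) = scalar_subst g B + scalar_subst (pderiv g) B * D + D\<^sup>2 * E"
    by blast
  have d: "scalar_subst (pderiv (pCons c g)) B = scalar_subst g B + B * scalar_subst (pderiv g) B"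
    by (simp add: pderiv_pCons scalar_subst_add scalar_subst_pCons)
  show ?case
    unfolding d unfolding scalar_subst_pCons E
    by (rule exI[of _ "scalar_subst (pderiv g) B + (B + D) * E"])
      (simp add: power2_eq_square algebra_simps)
qed

text \<open>
  The left-hand side is the error of \<open>B - b(B) p(B)\<close> as an approximation to \<open>B + D\<close>.  If \<open>B + D\<close>
  is a root of \<open>p\<close>, it is a multiple of \<open>D\<^sup>2\<close>, where \<open>D\<close> is the error of \<open>B\<close>; the second summand is the
  correction when \<open>B + D\<close> is only nearly a root.
\<close>
lemma newton_step:
  assumes bezout: "a * p + b * pderiv p = 1"
  shows "\<exists>E G. D + scalar_subst (b * p) B = D\<^sup>2 * E + scalar_subst p (B + D) * G"
proof -
  let ?a = "scalar_subst a B" and ?b = "scalar_subst b B"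
    and ?p = "scalar_subst p B" and ?p' = "scalar_subst (pderiv p) B"
  obtain E where E: "scalar_subst p (B + D) = ?p + ?p' * D + D\<^sup>2 * E"
    using scalar_subst_taylor by blast
  have one: "?a * ?p + ?b * ?p' = 1"
    using arg_cong[OF bezout, of "\<lambda>q. scalar_subst q B"]
    by (simp add: scalar_subst_add scalar_subst_mult scalar_subst_one)
  \<comment> \<open>Multiply \<open>D\<close> by \<open>1 = a p + b p'\<close> and replace \<open>p(B)\<close> by \<open>p(B + D) - p'(B) D - D\<^sup>2 E\<close>; the terms
    \<open>b(B) p'(B) D\<close> cancel.\<close>
  have "D + ?b * ?p = (?a * ?p + ?b * ?p') * D + ?b * ?p"
    unfolding one by simp
  also have "\<dots> = D\<^sup>2 * (- ?a * ?p' - (?b + D * ?a) * E) + scalar_subst p (B + D) * (?b + D * ?a)"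
    unfolding E by (simp add: power2_eq_square algebra_simps)
  finally show ?thesis
    unfolding scalar_subst_mult by blast
qed

text \<open>
  Here \<open>[:[:0, 1:]:]\<close> is \<open>x\<close> and \<open>[:0, 1:]\<close> is \<open>y\<close>: modulo the ideal generated by \<open>p(x)\<close> and a
  power of \<open>y\<close>, the variable \<open>x\<close> is a polynomial in \<open>x + y\<close>.  One Newton step even doubles the
  exponent; an increase by one is all that is recorded.
\<close>
lemma newton_approximation:
  fixes p :: "'a::idom poly"
  defines "x \<equiv> [:[:0, 1:]:]" and "y \<equiv> [:0, 1:]"
  assumes bezout: "a * p + b * pderiv p = 1"
  shows "\<exists>g Q R. x - scalar_subst g (x + y) = y ^ Suc k * Q + scalar_subst p x * R"
proof (induction k)
  case 0
  have "scalar_subst [:0, 1:] (x + y) = x + y"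
    by (simp only: scalar_subst_pCons scalar_subst_zero) (simp flip: one_pCons)
  then show ?case
    by (intro exI[of _ "[:0, 1:]"] exI[of _ "-1"] exI[of _ 0]) simp
next
  case (Suc k)
  then obtain g Q R
    where g: "x - scalar_subst g (x + y) = y ^ Suc k * Q + scalar_subst p x * R" by blast
  let ?B = "scalar_subst g (x + y)"
  let ?D = "x - ?B"
  obtain E G where step: "?D + scalar_subst (b * p) ?B = ?D\<^sup>2 * E + scalar_subst p x * G"
    using newton_step[OF bezout, of ?D ?B] by auto
  have "x - scalar_subst (g - pcompose (b * p) g) (x + y) = ?D + scalar_subst (b * p) ?B"
    by (simp add: scalar_subst_diff scalar_subst_pcompose)
  also have "\<dots> = (y ^ Suc k * Q + scalar_subst p x * R)\<^sup>2 * E + scalar_subst p x * G"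
    by (simp only: step) (simp only: g)
  also have "\<dots> = y ^ Suc (Suc k) * (y ^ k * Q\<^sup>2 * E)
      + scalar_subst p x * ((2 * y ^ Suc k * Q * R + scalar_subst p x * R\<^sup>2) * E + G)"
    by (simp add: power2_eq_square algebra_simps)
  finally show ?case by blast
qed

section \<open>The semisimple part is a polynomial in the matrix\<close>

lemma power_sum_in_ideal:
  fixes u v :: "'a::comm_ring_1"
  shows "\<exists>c d. (u + v) ^ (m + k) = u ^ m * c + v ^ k * d"
proof (induction "m + k" arbitrary: m k)
  case 0
  then show ?case by (intro exI[of _ 1] exI[of _ 0]) simp
next
  case (Suc n)
  show ?case
  proof (cases m)
    case 0
    then show ?thesis by (intro exI[of _ "(u + v) ^ k"] exI[of _ 0]) simp
  next
    case m: (Suc m')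
    show ?thesis
    proof (cases k)
      case 0
      then show ?thesis by (intro exI[of _ 0] exI[of _ "(u + v) ^ m"]) simp
    next
      case k: (Suc k')
      obtain c d where 1: "(u + v) ^ n = u ^ m' * c + v ^ k * d"
        using Suc.hyps(1)[of m' k] Suc.hyps(2) m by auto
      obtain c' d' where 2: "(u + v) ^ n = u ^ m * c' + v ^ k' * d'"
        using Suc.hyps(1)[of m k'] Suc.hyps(2) k by auto
      have "(u + v) ^ (m + k) = u * (u + v) ^ n + v * (u + v) ^ n"
        by (simp only: Suc.hyps(2)[symmetric] power_Suc distrib_right)
      also have "u * (u + v) ^ n = u ^ m * c + v ^ k * (u * d)"
        unfolding 1 m by (simp add: algebra_simps)
      also have "v * (u + v) ^ n = u ^ m * (v * c') + v ^ k * d'"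
        unfolding 2 k by (simp add: algebra_simps)
      finally have "(u + v) ^ (m + k) = u ^ m * (c + v * c') + v ^ k * (u * d + d')"
        by (simp add: algebra_simps)
      then show ?thesis by blast
    qed
  qed
qed

text \<open>
  For commuting \<open>S\<close> and \<open>N\<close> the evaluation \<open>x \<mapsto> S\<close>, \<open>y \<mapsto> N\<close> is a ring homomorphism on
  \<open>F[x][y]\<close>.
\<close>
locale commuting_matrices =
  fixes S N :: "'a::field^'n^'n"
  assumes commute: "S ** N = N ** S"
begin

lemma mat_poly_commute: "mat_poly q S ** N = N ** mat_poly q S"
proof (induction q)
  case (pCons c q)
  then show ?case
    by (simp add: uni.ev_pCons matrix_add_ldistrib matrix_add_rdistrib mat_commute)
      (metis commute matrix_mul_assoc)
qed (simp add: uni.ev_zero)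

sublocale bi: matrix_evaluation "\<lambda>q. mat_poly q S" N
  by unfold_locales (simp_all add: uni.ev_add uni.ev_mult uni.ev_one mat_poly_commute)

lemma ev_x: "bi.ev [:[:0, 1:]:] = S"
  by (simp add: bi.ev_const uni.ev_var)

lemma ev_scalar_subst: "bi.ev (scalar_subst g B) = mat_poly g (bi.ev B)"
  by (induction g)
    (simp_all add: scalar_subst_zero scalar_subst_pCons bi.ev_zero bi.ev_add bi.ev_mult
      bi.ev_const uni.ev_zero uni.ev_pCons uni.ev_const)

text \<open>
  Modulo the nilpotent \<open>y\<close>, \<open>p(x)\<close> agrees with \<open>p(x + y)\<close>, whose value is nilpotent.
\<close>
lemma nilpotent_eval_left:
  assumes p: "mat_poly (p ^ r) (S + N) = 0" and N: "mat_power N k = 0"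
  shows "mat_power (mat_poly p S) (r + k) = 0"
proof -
  let ?x = "[:[:0, 1:]:] :: 'a poly poly" and ?y = "[:0, 1:] :: 'a poly poly"
  obtain E where E: "scalar_subst p (?x + ?y)
      = scalar_subst p ?x + scalar_subst (pderiv p) ?x * ?y + ?y\<^sup>2 * E"
    using scalar_subst_taylor by blast
  let ?u = "scalar_subst p (?x + ?y)"
    and ?v = "?y * (- scalar_subst (pderiv p) ?x - ?y * E)"
  have split: "scalar_subst p ?x = ?u + ?v"
    unfolding E by (simp only: power2_eq_square algebra_simps) simp
  obtain c d where cd: "(?u + ?v) ^ (r + k) = ?u ^ r * c + ?v ^ k * d"
    using power_sum_in_ideal by blast
  have ev_sum: "bi.ev (?x + ?y) = S + N"
    by (simp only: bi.ev_add ev_x bi.ev_var)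
  have u: "bi.ev (?u ^ r) = 0"
    unfolding bi.ev_power ev_scalar_subst ev_sum using p by (simp add: uni.ev_power)
  have v: "bi.ev (?v ^ k) = 0"
    unfolding power_mult_distrib bi.ev_mult bi.ev_power bi.ev_var N by simp
  have "mat_power (mat_poly p S) (r + k) = bi.ev (scalar_subst p ?x ^ (r + k))"
    unfolding bi.ev_power ev_scalar_subst ev_x ..
  also have "\<dots> = 0"
    unfolding split cd bi.ev_add bi.ev_mult[of _ c] bi.ev_mult[of _ d] u v by simp
  finally show ?thesis .
qed

lemma root_is_polynomial_in_sum:
  assumes p: "mat_poly p S = 0" and coprime: "coprime p (pderiv p)" and N: "mat_power N k = 0"
  obtains g where "S = mat_poly g (S + N)"
proof -
  let ?x = "[:[:0, 1:]:] :: 'a poly poly" and ?y = "[:0, 1:] :: 'a poly poly"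
  obtain a b where bezout: "a * p + b * pderiv p = 1"
    using coprime_bezout[OF coprime] by blast
  obtain g Q R where
    g: "?x - scalar_subst g (?x + ?y) = ?y ^ Suc k * Q + scalar_subst p ?x * R"
    using newton_approximation[OF bezout] by blast
  have "S - mat_poly g (S + N) = bi.ev (?x - scalar_subst g (?x + ?y))"
    by (simp only: bi.ev_diff ev_scalar_subst bi.ev_add ev_x bi.ev_var)
  also have "\<dots> = mat_power N (Suc k) ** bi.ev Q + mat_poly p S ** bi.ev R"
    by (simp only: g bi.ev_add bi.ev_mult bi.ev_power bi.ev_var ev_scalar_subst ev_x)
  also have "\<dots> = 0"
    using p N by simp
  finally show thesis
    using that[of g] by simp
qed

end

text \<open>
  The kernel of \<open>q(S)\<close> has an \<open>S\<close>-invariant complement, on which \<open>q(S)\<close> is both injective and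
  nilpotent.  So the complement is zero.
\<close>
lemma semisimple_nilpotent_eval_zero:
  fixes S :: "'a::field^'n^'n"
  assumes "semisimple_mat S" and nil: "mat_power (mat_poly q S) m = 0"
  shows "mat_poly q S = 0"
proof -
  define T where "T = mat_poly q S"
  define U where "U = {v. T *v v = 0}"
  have "vec.subspace U"
    by (auto simp: U_def vec.subspace_def matrix_vector_right_distrib vector_scalar_commute)
  moreover have "(*v) S ` U \<subseteq> U"
  proof -
    have "T *v (S *v v) = S *v (T *v v)" for v
      by (simp add: matrix_vector_mul_assoc T_def uni.ev_commute_var)
    then show ?thesis by (auto simp: U_def)
  qed
  ultimately obtain W where W: "vec.subspace W" "(*v) S ` W \<subseteq> W" "U \<inter> W = {0}"
    and sum: "\<And>v. \<exists>u\<in>U. \<exists>w\<in>W. v = u + w"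
    using \<open>semisimple_mat S\<close> unfolding semisimple_mat_def by metis
  have "mat_poly f S *v w \<in> W" if "w \<in> W" for f w
  proof (induction f)
    case (pCons c f)
    with W that show ?case
      by (auto simp: mat_poly_mult_vector_pCons intro!: vec.subspace_add vec.subspace_scale)
  qed (simp add: uni.ev_zero vec.subspace_0[OF W(1)])
  then have TW: "T *v w \<in> W" if "w \<in> W" for w
    using that by (simp add: T_def)
  have W0: "w = 0" if "w \<in> W" "mat_power T j *v w = 0" for w j
    using that
  proof (induction j arbitrary: w)
    case (Suc j)
    have "mat_power T j *v (T *v w) = 0"
      using Suc.prems by (simp add: matrix_vector_mul_assoc mat_power_commute)
    with Suc.IH[OF TW[OF Suc.prems(1)]] have "T *v w = 0" by blast
    with W(3) Suc.prems(1) show ?case by (auto simp: U_def)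
  qed simp
  have "T *v v = 0 *v v" for v
  proof -
    obtain u w where "u \<in> U" "w \<in> W" "v = u + w" using sum by blast
    moreover have "w = 0"
      using W0[of w m] nil \<open>w \<in> W\<close> by (simp add: T_def)
    ultimately show ?thesis by (simp add: U_def)
  qed
  then show ?thesis
    by (simp add: T_def matrix_eq)
qed

section \<open>Transfer of linearity and invariance\<close>

lemma linear_commute_mat_poly:
  fixes A :: "'a::field^'n^'n"
  assumes lin: "linear_over UNIV (*s) X" and comm: "\<And>v. X (A *v v) = A *v X v"
  shows "X (mat_poly q A *v v) = mat_poly q A *v X v"
proof (induction q)
  case 0
  from lin have "X (0 + 0) = X 0 + X 0" unfolding linear_over_def by blast
  then show ?case by (simp add: uni.ev_zero)
next
  case (pCons c q)
  with lin show ?case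
    by (simp add: mat_poly_mult_vector_pCons linear_over_def comm)
qed

lemma subspace_mat_poly_closed:
  fixes A :: "'a::field^'n^'n"
  assumes sub: "subspace_over UNIV (*s) Y" and inv: "\<And>v. v \<in> Y \<Longrightarrow> A *v v \<in> Y"
    and "v \<in> Y"
  shows "mat_poly q A *v v \<in> Y"
proof (induction q)
  case 0
  from sub show ?case by (simp add: uni.ev_zero subspace_over_def)
next
  case (pCons c q)
  with sub inv \<open>v \<in> Y\<close> show ?case
    by (simp add: mat_poly_mult_vector_pCons subspace_over_def)
qed

lemma coeff_field_subset_mat_poly: "coeff_field S s \<subseteq> range (\<lambda>q. mat_poly q S)"
proof -
  have "(\<Sum>i<s. mat (a i) ** mat_power S i) = mat_poly (\<Sum>i<s. monom (a i) i) S"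
    for a :: "nat \<Rightarrow> 'a"
  proof (induction s)
    case (Suc s)
    have "monom (a s) s = smult (a s) ([:0, 1:] ^ s)"
      by (simp add: monom_altdef)
    then have "mat_poly (monom (a s) s) S = mat (a s) ** mat_power S s"
      by (simp only: uni.ev_smult uni.ev_power uni.ev_var)
    with Suc show ?case by (simp add: uni.ev_add)
  qed (simp add: uni.ev_zero)
  then show ?thesis by (auto simp: coeff_field_def)
qed

lemma mat_poly_in_coeff_field:
  assumes "degree q < s"
  shows "mat_poly q S \<in> coeff_field S s"
proof -
  have "mat_poly q S = (\<Sum>i\<le>s - 1. mat (coeff q i) ** mat_power S i)"
    unfolding mat_poly_eq_matrix_eval using assms by (intro matrix_eval_atMost) simp_all
  also have "{..s - 1} = {..<s}" using assms by auto
  finally show ?thesis by (auto simp: coeff_field_def)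
qed

text \<open>Reduction modulo \<open>p\<close> brings every polynomial in \<open>S\<close> below degree \<open>degree p\<close>.\<close>
lemma coeff_field_eq_mat_poly:
  assumes "mat_poly p S = 0" and "degree p > 0"
  shows "coeff_field S (degree p) = range (\<lambda>q. mat_poly q S)"
proof
  have "p \<noteq> 0" using assms(2) by auto
  show "range (\<lambda>q. mat_poly q S) \<subseteq> coeff_field S (degree p)"
  proof clarify
    fix q
    have "mat_poly q S = mat_poly (q div p * p + q mod p) S" by simp
    also have "\<dots> = mat_poly (q mod p) S"
      using assms(1) by (simp only: uni.ev_add uni.ev_mult) simp
    finally have "mat_poly q S = mat_poly (q mod p) S" .
    moreover have "degree (q mod p) < degree p"
      using \<open>p \<noteq> 0\<close> assms(2) degree_mod_less[of p q] by (cases "q mod p = 0") auto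
    ultimately show "mat_poly q S \<in> coeff_field S (degree p)"
      by (simp add: mat_poly_in_coeff_field)
  qed
qed (rule coeff_field_subset_mat_poly)

theorem lemma3p3:
  fixes A S N :: "'a::field^'n^'n" and p :: "'a poly" and r s :: nat
    and K :: "('a^'n^'n) set"
  assumes "r \<ge> 1"
    and "irreducible p" and "separable_poly p" and "degree p = s"
    and "is_minimal_poly A (p ^ r)"
    and "jordan_chevalley A S N"
    and "K = coeff_field S s"
  shows "ChinvF A = ChinvK K A \<and> ChinvK K A = ChinvK K N"
proof -
  from assms(6) have A: "A = S + N" and ss: "semisimple_mat S" and SN: "S ** N = N ** S"
    by (auto simp: jordan_chevalley_def)
  from assms(6) obtain k where N: "mat_power N k = 0"
    by (auto simp: jordan_chevalley_def nilpotent_mat_def)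
  interpret commuting_matrices S N by unfold_locales (rule SN)
  have pA: "mat_poly (p ^ r) (S + N) = 0"
    using assms(5) by (simp add: is_minimal_poly_def A)
  have pS: "mat_poly p S = 0"
    using semisimple_nilpotent_eval_zero[OF ss nilpotent_eval_left[OF pA N]] .
  obtain g where g: "S = mat_poly g A"
    using root_is_polynomial_in_sum[OF pS _ N] assms(3) by (auto simp: separable_poly_def A)
  have "degree p > 0"
    using \<open>irreducible p\<close> by (metis gr0I irreducible_def is_unit_iff_degree)
  then have K: "K = range (\<lambda>q. mat_poly q S)"
    using coeff_field_eq_mat_poly[OF pS] assms(4,7) by simp
  have matK: "mat c \<in> K" for c
    unfolding K using uni.ev_const[of c S] by (metis rangeI)
  have SK: "S \<in> K"
    unfolding K using uni.ev_var[of S] by (metis rangeI)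
  have Av: "A *v v = S *v v + N *v v" for v
    by (simp add: A matrix_vector_mult_add_rdistrib)

  have aut: "linear_over UNIV (*s) X \<and> (*v) A \<circ> X = X \<circ> (*v) A \<longleftrightarrow>
             linear_over K (*v) X \<and> (*v) A \<circ> X = X \<circ> (*v) A" for X
  proof (intro iffI conjI; (elim conjE)?)
    assume lin: "linear_over UNIV (*s) X" and "(*v) A \<circ> X = X \<circ> (*v) A"
    then have XA: "X (A *v v) = A *v X v" for v by (metis comp_apply)
    have XS: "X (S *v v) = S *v X v" for v
      using linear_commute_mat_poly[OF lin XA, of g] g by simp
    show "linear_over K (*v) X"
      using lin linear_commute_mat_poly[OF lin XS] by (auto simp: linear_over_def K)
  next
    assume "linear_over K (*v) X"
    then show "linear_over UNIV (*s) X"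
      using matK unfolding linear_over_def by (metis mat_mult_vector)
  qed auto

  have autN: "(*v) A \<circ> X = X \<circ> (*v) A \<longleftrightarrow> (*v) N \<circ> X = X \<circ> (*v) N"
    if "linear_over K (*v) X" for X
    using that SK by (simp add: fun_eq_iff Av linear_over_def)

  have sub: "subspace_over UNIV (*s) Y \<and> (*v) A ` Y \<subseteq> Y \<longleftrightarrow>
             subspace_over K (*v) Y \<and> (*v) A ` Y \<subseteq> Y" for Y
  proof (intro iffI conjI; (elim conjE)?)
    assume Y: "subspace_over UNIV (*s) Y" and "(*v) A ` Y \<subseteq> Y"
    then have YA: "A *v v \<in> Y" if "v \<in> Y" for v using that by blast
    have YS: "S *v v \<in> Y" if "v \<in> Y" for v
      using subspace_mat_poly_closed[OF Y YA that, of g] g by simp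
    show "subspace_over K (*v) Y"
      using Y subspace_mat_poly_closed[OF Y YS] by (auto simp: subspace_over_def K)
  next
    assume "subspace_over K (*v) Y"
    then show "subspace_over UNIV (*s) Y"
      using matK unfolding subspace_over_def by (metis mat_mult_vector)
  qed auto

  have subN: "(*v) A ` Y \<subseteq> Y \<longleftrightarrow> (*v) N ` Y \<subseteq> Y" if Y: "subspace_over K (*v) Y" for Y
  proof -
    have YS: "S *v v \<in> Y" if "v \<in> Y" for v
      using Y SK that by (simp add: subspace_over_def)
    \<comment> \<open>Closure under negation comes from the scalar matrix \<open>mat (- 1)\<close> in \<open>K\<close>.\<close>
    have "mat (- 1) *v (S *v v) \<in> Y" if "v \<in> Y" for v
      using Y matK YS[OF that] unfolding subspace_over_def by blast
    then have "- (S *v v) \<in> Y" if "v \<in> Y" for v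
      using that by (simp add: mat_mult_vector)
    moreover have "N *v v = A *v v + - (S *v v)" for v by (simp add: Av)
    ultimately show ?thesis
      using Y YS unfolding subspace_over_def image_subset_iff by (metis Av)
  qed

  have "ChinvF A = ChinvK K A"
    unfolding Chinv_def using sub aut by blast
  moreover have "ChinvK K A = ChinvK K N"
    unfolding Chinv_def using subN autN by blast
  ultimately show ?thesis ..
qed

end
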